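(* Let $\Sigma$ be a ring of subsets of a non-empty set $\Omega$. Then $(\Theta_{\mathcal{S}}, \ll, \sqcap, \sqcup, \Theta_D, \Theta_M)$ is a complete lattice, where $\Theta_{\mathcal S}=\{\Theta_S;\ S\in\mathcal S\}$ is the family of all spaces of semi-copula-based probabilistic submeasures on $\Sigma$, $\Theta_D$ is its top element and $\Theta_M$ is its bottom element.
   Context: A binary aggregation function is a function $A:[0,1]^2\to[0,1]$ that is non-decreasing in each variable with $A(0,0)=0$ and $A(1,1)=1$. A semi-copula is an aggregation function $S:[0,1]^2\to[0,1]$ with $1$ as its neutral element, i.e. $S(x,1)=S(1,x)=x$ for all $x\in[0,1]$; $\mathcal S$ is the set of all semi-copulas, ordered point-wise by $\leq$, with $\vee,\wedge$ denoting point-wise supremum and infimum. $M(x,y)=\min\{x,y\}$; $D(x,y)=\min\{x,y\}$ if $\max\{x,y\}=1$ and $D(x,y)=0$ otherwise. $\Delta^+$ is the set of distance distribution functions: non-decreasing functions $F:[-\infty,+\infty]\to[0,1]$, left-continuous on $\mathbb R$, with $F(x)=0$ for $x\le 0$ and $F(+\infty)=1$. $\varepsilon_0(x)=1$ for $x>0$ and $0$ otherwise. For $S\in\mathcal S$, $\Theta_S$ denotes the set of all $\tau_S$-submeasures on $\Sigma$, i.e. mappings $\gamma:\Sigma\to\Delta^+$ (with $\gamma(E)$ written $\gamma_E$) such that: (a') $\gamma_\emptyset(x)=\varepsilon_0(x)$ for $x>0$; (b') $\gamma_E(x)\ge\gamma_F(x)$ for $x>0$ whenever $E\subset F$, $E,F\in\Sigma$;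 (c') $\gamma_{E\cup F}(x+y)\ge S(\gamma_E(x),\gamma_F(y))$ for all $x,y>0$, $E,F\in\Sigma$. The elements $\Theta_S$ of $\Theta_{\mathcal S}$ are regarded as indexed by $S\in\mathcal S$, and the order and operations are defined through the indices: $\Theta_{S_1}\ll\Theta_{S_2}$ if and only if $S_2\le S_1$; $\Theta_{S_1}\sqcup\Theta_{S_2}=\Theta_{S_1\wedge S_2}$ (join) and $\Theta_{S_1}\sqcap\Theta_{S_2}=\Theta_{S_1\vee S_2}$ (meet). *)

theory Defs
  imports "HOL-Analysis.Analysis" "HOL-Algebra.Complete_Lattice"
begin

abbreviation unit_square :: "(real \<times> real) set" where
  "unit_square \<equiv> {0..1} \<times> {0..1}"

text \<open>Functions with domain \<open>[0,1]\<^sup>2\<close> are represented by extensional functions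
  (the set \<open>\<rightarrow>\<^sub>E\<close>), so that HOL equality is equality of functions on \<open>[0,1]\<^sup>2\<close>.\<close>

definition aggregation_functions :: "(real \<times> real \<Rightarrow> real) set" where
  "aggregation_functions = {A \<in> unit_square \<rightarrow>\<^sub>E {0..1}.
     (\<forall>x\<in>{0..1}. \<forall>y\<in>{0..1}. \<forall>z\<in>{0..1}. x \<le> y \<longrightarrow>
        A (x, z) \<le> A (y, z) \<and> A (z, x) \<le> A (z, y)) \<and>
     A (0, 0) = 0 \<and> A (1, 1) = 1}"

definition semicopulas :: "(real \<times> real \<Rightarrow> real) set" where
  "semicopulas = {S \<in> aggregation_functions. \<forall>x\<in>{0..1}. S (x, 1) = x \<and> S (1, x) = x}"

definition sc_le :: "(real \<times> real \<Rightarrow> real) \<Rightarrow> (real \<times> real \<Rightarrow> real) \<Rightarrow> bool" where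
  "sc_le S T \<longleftrightarrow> (\<forall>p\<in>unit_square. S p \<le> T p)"

definition sc_sup :: "(real \<times> real \<Rightarrow> real) \<Rightarrow> (real \<times> real \<Rightarrow> real) \<Rightarrow> real \<times> real \<Rightarrow> real" where
  "sc_sup S T = (\<lambda>p\<in>unit_square. max (S p) (T p))"

definition sc_inf :: "(real \<times> real \<Rightarrow> real) \<Rightarrow> (real \<times> real \<Rightarrow> real) \<Rightarrow> real \<times> real \<Rightarrow> real" where
  "sc_inf S T = (\<lambda>p\<in>unit_square. min (S p) (T p))"

definition semicopula_M :: "real \<times> real \<Rightarrow> real" where
  "semicopula_M = (\<lambda>(x, y)\<in>unit_square. min x y)"

definition semicopula_D :: "real \<times> real \<Rightarrow> real" where
  "semicopula_D = (\<lambda>(x, y)\<in>unit_square. if max x y = 1 then min x y else 0)"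

definition distance_dfs :: "(ereal \<Rightarrow> real) set" where
  "distance_dfs = {F. range F \<subseteq> {0..1} \<and> mono F \<and>
     (\<forall>x::real. continuous (at_left (ereal x)) F) \<and>
     (\<forall>x\<le>0. F x = 0) \<and> F \<infinity> = 1}"

definition eps0 :: "ereal \<Rightarrow> real" where
  "eps0 x = (if x > 0 then 1 else 0)"

text \<open>A submeasure has domain \<open>\<Sigma>\<close>, hence is extensional on \<open>\<Sigma>\<close>.\<close>

definition submeasures ::
    "'a set set \<Rightarrow> (real \<times> real \<Rightarrow> real) \<Rightarrow> ('a set \<Rightarrow> ereal \<Rightarrow> real) set" where
  "submeasures \<Sigma> S = {\<gamma> \<in> \<Sigma> \<rightarrow>\<^sub>E distance_dfs.
     (\<forall>x>0. \<gamma> {} x = eps0 x) \<and>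
     (\<forall>E\<in>\<Sigma>. \<forall>F\<in>\<Sigma>. E \<subseteq> F \<longrightarrow> (\<forall>x>0. \<gamma> E x \<ge> \<gamma> F x)) \<and>
     (\<forall>E\<in>\<Sigma>. \<forall>F\<in>\<Sigma>. \<forall>x>0. \<forall>y>0. \<gamma> (E \<union> F) (x + y) \<ge> S (\<gamma> E x, \<gamma> F y))}"

text \<open>The spaces of submeasures are regarded as indexed by the semi-copula: different
  semi-copulas may have equal sets of submeasures (for instance if \<open>\<Sigma> = {{}}\<close>), while
  order and operations refer to the index.  An element of the family is therefore the pair
  of the index \<open>S\<close> and the set \<open>submeasures \<Sigma> S\<close>.\<close>

type_synonym 'a submeasure_space =
  "(real \<times> real \<Rightarrow> real) \<times> ('a set \<Rightarrow> ereal \<Rightarrow> real) set"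

definition Theta :: "'a set set \<Rightarrow> (real \<times> real \<Rightarrow> real) \<Rightarrow> 'a submeasure_space" where
  "Theta \<Sigma> S = (S, submeasures \<Sigma> S)"

definition Theta_order :: "'a set set \<Rightarrow> 'a submeasure_space gorder" where
  "Theta_order \<Sigma> = \<lparr>carrier = Theta \<Sigma> ` semicopulas, eq = (=),
     le = (\<lambda>T1 T2. sc_le (fst T2) (fst T1))\<rparr>"

end

theory Submission
  imports Defs
begin

text \<open>Since \<open>\<Theta>\<^sub>S\<close> carries its index \<open>S\<close>, the map \<open>S \<mapsto> \<Theta>\<^sub>S\<close> is an order anti-isomorphism
  from the semi-copulas with the pointwise order onto the family of submeasure spaces. So the
  theorem is the dual of the statement that the semi-copulas form a complete lattice with bottom
  \<open>D\<close>, top \<open>M\<close> and pointwise binary suprema and infima.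

  That statement holds because monotonicity, the bounds \<open>0\<close> and \<open>1\<close>, and the neutral element
  \<open>1\<close> all pass to pointwise suprema (\<open>semicopulas_Sup\<close>) and to pointwise maxima and minima
  (\<open>semicopulas_sc_sup\<close>, \<open>semicopulas_sc_inf\<close>), and because the prescribed values on the two
  edges where a coordinate is \<open>1\<close>, with monotonicity, force \<open>D \<le> S \<le> M\<close>.

  A partial order with a top element in which every non-empty subset has an infimum is a complete
  lattice. Here the top is \<open>\<Theta>\<^sub>D\<close>, and the infimum of a non-empty family of spaces is
  indexed by the pointwise supremum of the indices. Thus arbitrary pointwise infima of
  semi-copulas are avoided; only the binary ones have to be examined, to identify the join.\<close>

section \<open>Semi-copulas\<close>

lemma semicopulaI:
  assumes "\<And>p. p \<notin> unit_square \<Longrightarrow> S p = undefined"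
    and "\<And>x y. x \<in> {0..1} \<Longrightarrow> y \<in> {0..1} \<Longrightarrow> 0 \<le> S (x, y) \<and> S (x, y) \<le> 1"
    and "\<And>x y z. \<lbrakk>x \<in> {0..1}; y \<in> {0..1}; z \<in> {0..1}; x \<le> y\<rbrakk>
          \<Longrightarrow> S (x, z) \<le> S (y, z) \<and> S (z, x) \<le> S (z, y)"
    and one: "\<And>x. x \<in> {0..1} \<Longrightarrow> S (x, 1) = x \<and> S (1, x) = x"
  shows "S \<in> semicopulas"
proof -
  \<comment> \<open>The corner value is squeezed between \<open>0\<close> and the edge value \<open>S (0, 1) = 0\<close>.\<close>
  have "S (0, 0) \<le> S (0, 1)" "0 \<le> S (0, 0)"
    using assms(2)[of 0 0] assms(3)[of 0 1 0] by auto
  then have "S (0, 0) = 0" using one[of 0] by simp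
  moreover have "S \<in> unit_square \<rightarrow>\<^sub>E {0..1}"
    using assms(2) by (intro PiE_I assms(1)) auto
  moreover have "S (1, 1) = 1" using one[of 1] by simp
  ultimately show ?thesis
    using assms(3) one unfolding semicopulas_def aggregation_functions_def by simp
qed

lemma semicopula_undefined: "S \<in> semicopulas \<Longrightarrow> p \<notin> unit_square \<Longrightarrow> S p = undefined"
  unfolding semicopulas_def aggregation_functions_def by (blast intro: PiE_arb)

lemma semicopula_bounds:
  assumes "S \<in> semicopulas" "x \<in> {0..1}" "y \<in> {0..1}"
  shows "0 \<le> S (x, y)" "S (x, y) \<le> 1"
proof -
  have "S (x, y) \<in> {0..1}"
    using assms unfolding semicopulas_def aggregation_functions_def by (blast intro: PiE_mem)
  then show "0 \<le> S (x, y)" "S (x, y) \<le> 1" by auto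
qed

lemma semicopula_mono:
  assumes "S \<in> semicopulas" "x \<in> {0..1}" "y \<in> {0..1}" "z \<in> {0..1}" "x \<le> y"
  shows "S (x, z) \<le> S (y, z)" "S (z, x) \<le> S (z, y)"
  using assms unfolding semicopulas_def aggregation_functions_def by blast+

lemma semicopula_one:
  assumes "S \<in> semicopulas" "x \<in> {0..1}"
  shows "S (x, 1) = x" "S (1, x) = x"
  using assms unfolding semicopulas_def by blast+

lemma semicopula_M_in: "semicopula_M \<in> semicopulas"
  by (rule semicopulaI) (auto simp: semicopula_M_def)

lemma semicopula_D_in: "semicopula_D \<in> semicopulas"
  by (rule semicopulaI) (auto simp: semicopula_D_def)

text \<open>Raising one coordinate to \<open>1\<close> leaves the other as the value, so each coordinate bounds
  \<open>S\<close> from above.\<close>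

lemma semicopula_le_M: "S \<in> semicopulas \<Longrightarrow> sc_le S semicopula_M"
  unfolding sc_le_def
proof clarify
  fix x y :: real
  assume S: "S \<in> semicopulas" and xy: "x \<in> {0..1}" "y \<in> {0..1}"
  have "S (x, y) \<le> S (x, 1)" "S (x, y) \<le> S (1, y)"
    using S xy by (auto intro: semicopula_mono)
  then show "S (x, y) \<le> semicopula_M (x, y)"
    using semicopula_one[OF S] xy by (auto simp: semicopula_M_def)
qed

text \<open>Every semi-copula agrees with \<open>D\<close> on the edges where a coordinate is \<open>1\<close>, and \<open>D\<close> vanishes
  elsewhere.\<close>

lemma semicopula_D_le: "S \<in> semicopulas \<Longrightarrow> sc_le semicopula_D S"
  unfolding sc_le_def
proof clarify
  fix x y :: real
  assume S: "S \<in> semicopulas" and xy: "x \<in> {0..1}" "y \<in> {0..1}"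
  show "semicopula_D (x, y) \<le> S (x, y)"
    using semicopula_one[OF S] semicopula_bounds[OF S] xy
    by (auto simp: semicopula_D_def max_def split: if_splits)
qed

lemma sc_le_trans: "sc_le S T \<Longrightarrow> sc_le T U \<Longrightarrow> sc_le S U"
  unfolding sc_le_def by (meson order_trans)

lemma sc_le_antisym:
  assumes "S \<in> semicopulas" "T \<in> semicopulas" "sc_le S T" "sc_le T S"
  shows "S = T"
proof
  fix p show "S p = T p"
    using assms semicopula_undefined[of S p] semicopula_undefined[of T p]
    by (cases "p \<in> unit_square") (auto simp: sc_le_def intro: order.antisym)
qed

lemma semicopulas_sc_sup:
  assumes S: "S \<in> semicopulas" and T: "T \<in> semicopulas"
  shows "sc_sup S T \<in> semicopulas"
proof (rule semicopulaI)
  show "sc_sup S T (x, z) \<le> sc_sup S T (y, z) \<and> sc_sup S T (z, x) \<le> sc_sup S T (z, y)"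
    if "x \<in> {0..1}" "y \<in> {0..1}" "z \<in> {0..1}" "x \<le> y" for x y z
    using that semicopula_mono[OF S that] semicopula_mono[OF T that]
    unfolding sc_sup_def by (auto intro!: max.mono simp del: max.bounded_iff)
  show "0 \<le> sc_sup S T (x, y) \<and> sc_sup S T (x, y) \<le> 1"
    if "x \<in> {0..1}" "y \<in> {0..1}" for x y
    using that semicopula_bounds[OF S that] semicopula_bounds[OF T that]
    by (simp add: sc_sup_def le_max_iff_disj)
qed (use semicopula_one[OF S] semicopula_one[OF T] in \<open>auto simp: sc_sup_def\<close>)

lemma semicopulas_sc_inf:
  assumes S: "S \<in> semicopulas" and T: "T \<in> semicopulas"
  shows "sc_inf S T \<in> semicopulas"
proof (rule semicopulaI)
  show "sc_inf S T (x, z) \<le> sc_inf S T (y, z) \<and> sc_inf S T (z, x) \<le> sc_inf S T (z, y)"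
    if "x \<in> {0..1}" "y \<in> {0..1}" "z \<in> {0..1}" "x \<le> y" for x y z
    using that semicopula_mono[OF S that] semicopula_mono[OF T that]
    unfolding sc_inf_def by (auto intro!: min.mono simp del: min.bounded_iff)
  show "0 \<le> sc_inf S T (x, y) \<and> sc_inf S T (x, y) \<le> 1"
    if "x \<in> {0..1}" "y \<in> {0..1}" for x y
    using that semicopula_bounds[OF S that] semicopula_bounds[OF T that]
    by (simp add: sc_inf_def min_le_iff_disj)
qed (use semicopula_one[OF S] semicopula_one[OF T] in \<open>auto simp: sc_inf_def\<close>)

section \<open>Suprema of families of semi-copulas\<close>

text \<open>The supremum is taken in the reals rather than in \<open>[0,1]\<close>, so it has its intended meaning
  only for non-empty families; the bound \<open>1\<close> makes it exist for them.\<close>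

definition sc_Sup :: "(real \<times> real \<Rightarrow> real) set \<Rightarrow> real \<times> real \<Rightarrow> real" where
  "sc_Sup K = (\<lambda>p\<in>unit_square. SUP S\<in>K. S p)"

lemma semicopulas_bdd_above:
  assumes "K \<subseteq> semicopulas" "p \<in> unit_square"
  shows "bdd_above ((\<lambda>S. S p) ` K)"
  using assms by (intro bdd_aboveI[where M = 1]) (auto intro: semicopula_bounds(2))

lemma sc_Sup_upper:
  assumes "K \<subseteq> semicopulas" "S \<in> K"
  shows "sc_le S (sc_Sup K)"
  unfolding sc_le_def
proof
  fix p :: "real \<times> real" assume p: "p \<in> unit_square"
  have "S p \<le> (SUP S\<in>K. S p)"
    by (rule cSUP_upper[OF assms(2) semicopulas_bdd_above[OF assms(1) p]])
  with p show "S p \<le> sc_Sup K p" by (simp add: sc_Sup_def)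
qed

lemma sc_Sup_least:
  assumes "K \<noteq> {}" "\<And>S. S \<in> K \<Longrightarrow> sc_le S T"
  shows "sc_le (sc_Sup K) T"
  unfolding sc_le_def
proof
  fix p :: "real \<times> real" assume p: "p \<in> unit_square"
  have "(SUP S\<in>K. S p) \<le> T p"
    by (rule cSUP_least) (use assms p in \<open>auto simp: sc_le_def\<close>)
  with p show "sc_Sup K p \<le> T p" by (simp add: sc_Sup_def)
qed

lemma semicopulas_Sup:
  assumes K: "K \<subseteq> semicopulas" "K \<noteq> {}"
  shows "sc_Sup K \<in> semicopulas"
proof -
  have eq: "sc_Sup K (x, y) = (SUP S\<in>K. S (x, y))" if "x \<in> {0..1}" "y \<in> {0..1}" for x y
    using that by (simp add: sc_Sup_def)
  have mono: "(SUP S\<in>K. S p) \<le> (SUP S\<in>K. S q)"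
    if "q \<in> unit_square" "\<And>S. S \<in> K \<Longrightarrow> S p \<le> S q" for p q
    using that K by (intro cSUP_mono semicopulas_bdd_above) auto
  show ?thesis
  proof (rule semicopulaI)
    show "sc_Sup K p = undefined" if "p \<notin> unit_square" for p
      using that by (auto simp: sc_Sup_def)
  next
    fix x y :: real assume xy: "x \<in> {0..1}" "y \<in> {0..1}"
    obtain S where S: "S \<in> K" using K by blast
    have "0 \<le> S (x, y)" using S K xy by (auto intro: semicopula_bounds)
    also have "\<dots> \<le> sc_Sup K (x, y)"
      using sc_Sup_upper[OF K(1) S] xy by (simp add: sc_le_def)
    finally have "0 \<le> sc_Sup K (x, y)" .
    moreover have "(SUP S\<in>K. S (x, y)) \<le> 1"
      using K xy by (intro cSUP_least) (auto intro: semicopula_bounds(2))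
    ultimately show "0 \<le> sc_Sup K (x, y) \<and> sc_Sup K (x, y) \<le> 1" using eq xy by simp
  next
    fix x y z :: real assume xyz: "x \<in> {0..1}" "y \<in> {0..1}" "z \<in> {0..1}" "x \<le> y"
    have "(SUP S\<in>K. S (x, z)) \<le> (SUP S\<in>K. S (y, z))"
      using K xyz by (intro mono) (auto intro: semicopula_mono)
    moreover have "(SUP S\<in>K. S (z, x)) \<le> (SUP S\<in>K. S (z, y))"
      using K xyz by (intro mono) (auto intro: semicopula_mono)
    ultimately show "sc_Sup K (x, z) \<le> sc_Sup K (y, z) \<and> sc_Sup K (z, x) \<le> sc_Sup K (z, y)"
      using eq xyz by simp
  next
    fix x :: real assume x: "x \<in> {0..1}"
    have "(SUP S\<in>K. S (x, 1)) = (SUP S\<in>K. x)" "(SUP S\<in>K. S (1, x)) = (SUP S\<in>K. x)"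
      using K x semicopula_one by (intro SUP_cong refl; blast)+
    then show "sc_Sup K (x, 1) = x \<and> sc_Sup K (1, x) = x"
      using eq x K by simp
  qed
qed

section \<open>The lattice of submeasure spaces\<close>

lemma Theta_carrier: "T \<in> carrier (Theta_order \<Sigma>) \<longleftrightarrow> (\<exists>S\<in>semicopulas. T = Theta \<Sigma> S)"
  by (auto simp: Theta_order_def)

lemma Theta_le: "Theta \<Sigma> S \<sqsubseteq>\<^bsub>Theta_order \<Sigma>\<^esub> Theta \<Sigma> T \<longleftrightarrow> sc_le T S"
  by (simp add: Theta_order_def Theta_def)

lemma partial_order_Theta: "partial_order (Theta_order \<Sigma>)"
proof
  show "(.=\<^bsub>Theta_order \<Sigma>\<^esub>) = (=)" by (simp add: Theta_order_def)
  show "T .=\<^bsub>Theta_order \<Sigma>\<^esub> U"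
    if "T \<sqsubseteq>\<^bsub>Theta_order \<Sigma>\<^esub> U" "U \<sqsubseteq>\<^bsub>Theta_order \<Sigma>\<^esub> T"
      "T \<in> carrier (Theta_order \<Sigma>)" "U \<in> carrier (Theta_order \<Sigma>)" for T U
    using that by (auto simp: Theta_order_def Theta_def dest: sc_le_antisym)
  show "T \<sqsubseteq>\<^bsub>Theta_order \<Sigma>\<^esub> V"
    if "T \<sqsubseteq>\<^bsub>Theta_order \<Sigma>\<^esub> U" "U \<sqsubseteq>\<^bsub>Theta_order \<Sigma>\<^esub> V" for T U V
    using that by (auto simp: Theta_order_def intro: sc_le_trans)
qed (auto simp: Theta_order_def sc_le_def)

text \<open>Extremal bounds are computed on the indices: as the order is reversed, a supremum of
  indices gives an infimum of spaces, and dually.\<close>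

lemma Theta_greatest_Lower:
  assumes "K \<subseteq> semicopulas" and "S \<in> semicopulas"
    and "\<And>T. T \<in> K \<Longrightarrow> sc_le T S"
    and "\<And>U. U \<in> semicopulas \<Longrightarrow> (\<And>T. T \<in> K \<Longrightarrow> sc_le T U) \<Longrightarrow> sc_le S U"
  shows "greatest (Theta_order \<Sigma>) (Theta \<Sigma> S) (Lower (Theta_order \<Sigma>) (Theta \<Sigma> ` K))"
proof (rule greatest_LowerI)
  fix T assume "T \<in> Theta \<Sigma> ` K"
  then show "Theta \<Sigma> S \<sqsubseteq>\<^bsub>Theta_order \<Sigma>\<^esub> T" using assms(3) by (auto simp: Theta_le)
next
  fix V assume V: "V \<in> Lower (Theta_order \<Sigma>) (Theta \<Sigma> ` K)"
  then obtain U where U: "U \<in> semicopulas" "V = Theta \<Sigma> U"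
    by (auto simp: Lower_def Theta_carrier)
  have "sc_le T U" if "T \<in> K" for T
  proof -
    have "V \<sqsubseteq>\<^bsub>Theta_order \<Sigma>\<^esub> Theta \<Sigma> T"
      using V that assms(1) unfolding Lower_def by (blast intro: Theta_carrier[THEN iffD2])
    then show ?thesis by (simp add: U Theta_le)
  qed
  then show "V \<sqsubseteq>\<^bsub>Theta_order \<Sigma>\<^esub> Theta \<Sigma> S"
    using assms(4) U by (simp add: Theta_le)
qed (use assms(1,2) in \<open>unfold Theta_carrier subset_eq, blast+\<close>)

lemma Theta_least_Upper:
  assumes "K \<subseteq> semicopulas" and "S \<in> semicopulas"
    and "\<And>T. T \<in> K \<Longrightarrow> sc_le S T"
    and "\<And>U. U \<in> semicopulas \<Longrightarrow> (\<And>T. T \<in> K \<Longrightarrow> sc_le U T) \<Longrightarrow> sc_le U S"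
  shows "least (Theta_order \<Sigma>) (Theta \<Sigma> S) (Upper (Theta_order \<Sigma>) (Theta \<Sigma> ` K))"
proof (rule least_UpperI)
  fix T assume "T \<in> Theta \<Sigma> ` K"
  then show "T \<sqsubseteq>\<^bsub>Theta_order \<Sigma>\<^esub> Theta \<Sigma> S" using assms(3) by (auto simp: Theta_le)
next
  fix V assume V: "V \<in> Upper (Theta_order \<Sigma>) (Theta \<Sigma> ` K)"
  then obtain U where U: "U \<in> semicopulas" "V = Theta \<Sigma> U"
    by (auto simp: Upper_def Theta_carrier)
  have "sc_le U T" if "T \<in> K" for T
  proof -
    have "Theta \<Sigma> T \<sqsubseteq>\<^bsub>Theta_order \<Sigma>\<^esub> V"
      using V that assms(1) unfolding Upper_def by (blast intro: Theta_carrier[THEN iffD2])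
    then show ?thesis by (simp add: U Theta_le)
  qed
  then show "Theta \<Sigma> S \<sqsubseteq>\<^bsub>Theta_order \<Sigma>\<^esub> V"
    using assms(4) U by (simp add: Theta_le)
qed (use assms(1,2) in \<open>unfold Theta_carrier subset_eq, blast+\<close>)

lemma Theta_D_greatest:
  "greatest (Theta_order \<Sigma>) (Theta \<Sigma> semicopula_D) (carrier (Theta_order \<Sigma>))"
  by (auto simp: greatest_def Theta_carrier Theta_le semicopula_D_in semicopula_D_le)

lemma Theta_M_least:
  "least (Theta_order \<Sigma>) (Theta \<Sigma> semicopula_M) (carrier (Theta_order \<Sigma>))"
  by (auto simp: least_def Theta_carrier Theta_le semicopula_M_in semicopula_le_M)

lemma complete_lattice_Theta: "complete_lattice (Theta_order \<Sigma>)"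
proof (rule partial_order.complete_lattice_criterion1[OF partial_order_Theta])
  show "\<exists>g. greatest (Theta_order \<Sigma>) g (carrier (Theta_order \<Sigma>))"
    using Theta_D_greatest by blast
next
  fix A assume "A \<subseteq> carrier (Theta_order \<Sigma>)" "A \<noteq> {}"
  then obtain K where K: "K \<subseteq> semicopulas" "K \<noteq> {}" "A = Theta \<Sigma> ` K"
    by (auto simp: Theta_order_def subset_image_iff)
  have "greatest (Theta_order \<Sigma>) (Theta \<Sigma> (sc_Sup K)) (Lower (Theta_order \<Sigma>) (Theta \<Sigma> ` K))"
    using K by (intro Theta_greatest_Lower semicopulas_Sup sc_Sup_upper sc_Sup_least)
  then show "\<exists>i. greatest (Theta_order \<Sigma>) i (Lower (Theta_order \<Sigma>) A)"
    using K(3) by blast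
qed

text \<open>In a partial order the choice operators behind meet and join can only select the
  extremal bound, so exhibiting one determines the value.\<close>

lemma Theta_meet:
  assumes "S \<in> semicopulas" "T \<in> semicopulas"
  shows "Theta \<Sigma> S \<sqinter>\<^bsub>Theta_order \<Sigma>\<^esub> Theta \<Sigma> T = Theta \<Sigma> (sc_sup S T)"
proof -
  have "greatest (Theta_order \<Sigma>) (Theta \<Sigma> (sc_sup S T))
      (Lower (Theta_order \<Sigma>) (Theta \<Sigma> ` {S, T}))"
    by (rule Theta_greatest_Lower)
      (use assms semicopulas_sc_sup[OF assms] in \<open>auto simp: sc_le_def sc_sup_def\<close>)
  then show ?thesis
    unfolding meet_def inf_def
    by (intro some_equality) (auto intro: partial_order.greatest_unique[OF partial_order_Theta])
qed

lemma Theta_join: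
  assumes "S \<in> semicopulas" "T \<in> semicopulas"
  shows "Theta \<Sigma> S \<squnion>\<^bsub>Theta_order \<Sigma>\<^esub> Theta \<Sigma> T = Theta \<Sigma> (sc_inf S T)"
proof -
  have "least (Theta_order \<Sigma>) (Theta \<Sigma> (sc_inf S T))
      (Upper (Theta_order \<Sigma>) (Theta \<Sigma> ` {S, T}))"
    by (rule Theta_least_Upper)
      (use assms semicopulas_sc_inf[OF assms] in \<open>auto simp: sc_le_def sc_inf_def\<close>)
  then show ?thesis
    unfolding join_def sup_def
    by (intro some_equality) (auto intro: partial_order.least_unique[OF partial_order_Theta])
qed

theorem theorem4p7:
  fixes \<Omega> :: "'a set" and \<Sigma> :: "'a set set"
  assumes "\<Omega> \<noteq> {}" and "ring_of_sets \<Omega> \<Sigma>"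
  shows "complete_lattice (Theta_order \<Sigma>) \<and>
    (\<forall>S1\<in>semicopulas. \<forall>S2\<in>semicopulas.
       Theta \<Sigma> S1 \<sqinter>\<^bsub>Theta_order \<Sigma>\<^esub> Theta \<Sigma> S2 = Theta \<Sigma> (sc_sup S1 S2) \<and>
       Theta \<Sigma> S1 \<squnion>\<^bsub>Theta_order \<Sigma>\<^esub> Theta \<Sigma> S2 = Theta \<Sigma> (sc_inf S1 S2)) \<and>
    greatest (Theta_order \<Sigma>) (Theta \<Sigma> semicopula_D) (carrier (Theta_order \<Sigma>)) \<and>
    least (Theta_order \<Sigma>) (Theta \<Sigma> semicopula_M) (carrier (Theta_order \<Sigma>))"
  by (simp add: complete_lattice_Theta Theta_meet Theta_join Theta_D_greatest Theta_M_least)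

end
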